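(* Let $q\in[1,\infty)$, $s\in\mathbb{N}$, $s\ge 1$, let $\|\cdot\|$ be a norm on $\mathbb{C}^{n\times n}$, and let $\mathcal{A}:\mathbb{R}^N\to\mathbb{C}^{n\times n}$ be a linear map such that (i) $\mathcal{A}$ satisfies the $\ell^q$-robust nullspace property of order $s$ with respect to $\|\cdot\|$ with parameters $\rho\in[0,1)$ and $\tau>0$, and (ii) there is a matrix $T\in\mathbb{C}^{n\times n}$ such that $w:=\mathcal{A}^*(T)$ is componentwise strictly positive; let $\kappa:=\kappa(\mathcal{A}^*(T))=\max_{i\in[N]}|w_i|/\min_{i\in[N]}|w_i|$. If $\rho\kappa<1$, then for every componentwise nonnegative $x\in\mathbb{R}^N$ and every $E\in\mathbb{C}^{n\times n}$, any solution $$x^\sharp\in\arg\min_{z\in\mathbb{R}^N,\ z\ge 0}\|\mathcal{A}(z)-Y\|\qquad\text{with } Y=\mathcal{A}(x)+E$$ obeys, for all $p\in[1,q]$, $$\|x^\sharp-x\|_p\le \frac{C'\kappa\,\sigma_s(x)_1}{s^{1-\frac1p}}+\frac{D'\kappa}{s^{\frac1q-\frac1p}}\left(\tau+\frac{\theta}{s^{1-\frac1q}}\right)\|E\|,$$ where $C':=2\frac{(1+\kappa\rho)^2}{1-\kappa\rho}$, $D':=2\frac{3+\kappa\rho}{1-\kappa\rho}$ and $\theta:=\|\mathcal{A}^*(T)\|_\infty^{-1}\cdot\|T\|^\circ$.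
   Context: Notation: $[N]=\{1,\dots,N\}$. $\mathbb{C}^{n\times n}$ carries the inner product $\langle X,Y\rangle=\operatorname{tr}(X^*Y)$. The map $\mathcal{A}$ is real-linear; its adjoint is $\mathcal{A}^*(T)=(\langle \mathcal{A}(e_i),T\rangle)_{i=1}^N$ with $e_i$ the standard basis of $\mathbb{R}^N$; "strictly positive" means every entry is real and $>0$. The dual norm of $\|\cdot\|$ is $\|Y\|^\circ=\sup_{\|X\|\le1}|\langle Y,X\rangle|=\sup_{\|X\|\le 1}\operatorname{Re}\langle Y,X\rangle$. For vectors, $\|\cdot\|_p$ is the $\ell^p$-norm. For $v\in\mathbb{R}^N$ and $S\subseteq[N]$, $v_S\in\mathbb{R}^N$ agrees with $v$ on $S$ and is zero elsewhere; $S^c=[N]\setminus S$; $|S|$ is the cardinality. $\sigma_s(x)_1=\min_{|S|\le s}\|x-x_S\|_1$. $\ell^q$-robust nullspace property of order $s$ with respect to $\|\cdot\|$ with parameters $\rho,\tau$: for all $S\subseteq[N]$ with $|S|\le s$ and all $v\in\mathbb{R}^N$, $$\|v_S\|_q\le\frac{\rho}{s^{1-1/q}}\|v_{S^c}\|_1+\tau\|\mathcal{A}(v)\|.$$ *)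

theory Defs
  imports "HOL-Analysis.Analysis"
begin

definition adjoint_matrix :: "complex^'n^'n \<Rightarrow> complex^'n^'n" where
  "adjoint_matrix X = map_matrix cnj (transpose X)"

(* conjugate-linear in the first argument *)
definition matrix_inner :: "complex^'n^'n \<Rightarrow> complex^'n^'n \<Rightarrow> complex" where
  "matrix_inner X Y = trace (adjoint_matrix X ** Y)"

(* An arbitrary norm on the complex vector space of matrices; homogeneity is over the complex
   scalars. It is a variable, unrelated to the type class norm of complex^'n^'n. *)
definition is_matrix_norm :: "(complex^'n^'n \<Rightarrow> real) \<Rightarrow> bool" where
  "is_matrix_norm nrm \<longleftrightarrow>
     (\<forall>X. 0 \<le> nrm X) \<and>
     (\<forall>X. nrm X = 0 \<longleftrightarrow> X = 0) \<and>
     (\<forall>c X. nrm (\<chi> i j. c * X $ i $ j) = cmod c * nrm X) \<and>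
     (\<forall>X Y. nrm (X + Y) \<le> nrm X + nrm Y)"

definition dual_norm :: "(complex^'n^'n \<Rightarrow> real) \<Rightarrow> complex^'n^'n \<Rightarrow> real" where
  "dual_norm nrm Y = (SUP X\<in>{X. nrm X \<le> 1}. cmod (matrix_inner Y X))"

(* The adjoint has complex entries in general, since A is only real-linear; it is therefore not
   the library's adjoint with respect to the real inner product. *)
definition measurement_adjoint ::
    "(real^'m \<Rightarrow> complex^'n^'n) \<Rightarrow> complex^'n^'n \<Rightarrow> complex^'m" where
  "measurement_adjoint A T = (\<chi> i. matrix_inner (A (axis i 1)) T)"

definition strictly_positive :: "complex^'m \<Rightarrow> bool" where
  "strictly_positive w \<longleftrightarrow> (\<forall>i. w $ i \<in> \<real> \<and> 0 < Re (w $ i))"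

definition lp_norm :: "real \<Rightarrow> real^'m \<Rightarrow> real" where
  "lp_norm p v = (\<Sum>i\<in>UNIV. \<bar>v $ i\<bar> powr p) powr (1 / p)"

definition linf_norm :: "complex^'m \<Rightarrow> real" where
  "linf_norm w = Max (range (\<lambda>i. cmod (w $ i)))"

definition kappa :: "complex^'m \<Rightarrow> real" where
  "kappa w = Max (range (\<lambda>i. cmod (w $ i))) / Min (range (\<lambda>i. cmod (w $ i)))"

definition vec_restrict :: "real^'m \<Rightarrow> 'm set \<Rightarrow> real^'m" where
  "vec_restrict v S = (\<chi> i. if i \<in> S then v $ i else 0)"

definition best_approx_error :: "nat \<Rightarrow> real^'m \<Rightarrow> real" where
  "best_approx_error s x = Min ((\<lambda>S. lp_norm 1 (x - vec_restrict x S)) ` {S. card S \<le> s})"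

definition robust_nullspace_property ::
    "real \<Rightarrow> nat \<Rightarrow> (complex^'n^'n \<Rightarrow> real) \<Rightarrow> (real^'m \<Rightarrow> complex^'n^'n) \<Rightarrow> real \<Rightarrow> real \<Rightarrow> bool" where
  "robust_nullspace_property q s nrm A \<rho> \<tau> \<longleftrightarrow>
     (\<forall>S v. card S \<le> s \<longrightarrow>
        lp_norm q (vec_restrict v S)
          \<le> \<rho> / real s powr (1 - 1 / q) * lp_norm 1 (vec_restrict v (- S)) + \<tau> * nrm (A v))"

end

theory Submission
  imports Defs
begin

text \<open>Write \<open>w = A\<^sup>*(T)\<close> and rescale coordinates by \<open>W = diag w\<close>. The map \<open>A W\<^sup>-\<^sup>1\<close> inherits the
  nullspace property with parameters \<open>\<kappa> \<rho>\<close> and \<open>max w \<cdot> \<tau>\<close>, so the usual stability estimate controls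
  \<open>W xs - W x\<close> by \<open>\<parallel>W xs\<parallel>\<^sub>1 - \<parallel>W x\<parallel>\<^sub>1\<close>, the best approximation error and the measurement error.
  Since \<open>xs\<close> and \<open>x\<close> are nonnegative, the difference of the weighted norms is the linear functional
  \<open>\<langle>T, A (xs - x)\<rangle>\<close>, at most the dual norm of \<open>T\<close> times the measurement error; this replaces the
  \<open>\<ell>\<^sup>1\<close> minimisation of the classical argument. Optimality of \<open>xs\<close> bounds the measurement error by
  twice the norm of \<open>E\<close>.\<close>

section \<open>The lp norms on finite-dimensional real vectors\<close>

lemma lp_norm_nonneg: "0 \<le> lp_norm p v"
  by (simp add: lp_norm_def)

lemma lp_norm_1: "lp_norm 1 v = (\<Sum>i\<in>UNIV. \<bar>v $ i\<bar>)"
  by (simp add: lp_norm_def sum_nonneg)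

lemma lp_norm_powr:
  assumes "0 < p"
  shows "lp_norm p v powr p = (\<Sum>i\<in>UNIV. \<bar>v $ i\<bar> powr p)"
  using assms by (simp add: lp_norm_def powr_powr sum_nonneg)

lemma lp_norm_le_iff:
  assumes "0 < p" "0 \<le> b"
  shows "lp_norm p v \<le> b \<longleftrightarrow> (\<Sum>i\<in>UNIV. \<bar>v $ i\<bar> powr p) \<le> b powr p"
  using assms powr_mono2 [of p "lp_norm p v" b] powr_less_mono2 [of p b "lp_norm p v"]
  by (auto simp: lp_norm_powr [symmetric] lp_norm_nonneg not_le [symmetric])

lemma lp_norm_mono:
  assumes "0 < p" "\<And>i. \<bar>u $ i\<bar> \<le> \<bar>v $ i\<bar>"
  shows "lp_norm p u \<le> lp_norm p v"
  unfolding lp_norm_def using assms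
  by (intro powr_mono2 sum_mono sum_nonneg) auto

lemma lp_norm_scaleR:
  assumes "0 < p"
  shows "lp_norm p (c *\<^sub>R v) = \<bar>c\<bar> * lp_norm p v"
  using assms
  by (simp add: lp_norm_def abs_mult powr_mult powr_powr sum_nonneg flip: sum_distrib_left)

lemma sum_vec_restrict:
  assumes "f 0 = (0::real)"
  shows "(\<Sum>i\<in>UNIV. f (vec_restrict v S $ i)) = (\<Sum>i\<in>S. f (v $ i))"
proof -
  have "(\<Sum>i\<in>UNIV. f (vec_restrict v S $ i)) = (\<Sum>i\<in>UNIV. if i \<in> S then f (v $ i) else 0)"
    using assms by (intro sum.cong) (auto simp: vec_restrict_def)
  then show ?thesis
    by (simp flip: sum.inter_restrict)
qed

lemma diff_vec_restrict: "v - vec_restrict v S = vec_restrict v (- S)"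
  by (auto simp: vec_eq_iff vec_restrict_def)

lemma lp_norm_1_vec_restrict: "lp_norm 1 (vec_restrict v S) = (\<Sum>i\<in>S. \<bar>v $ i\<bar>)"
  using sum_vec_restrict [of abs] by (simp add: lp_norm_1)

lemma lp_norm_1_split: "lp_norm 1 v = lp_norm 1 (vec_restrict v S) + lp_norm 1 (vec_restrict v (- S))"
  unfolding lp_norm_1_vec_restrict unfolding lp_norm_1
  using sum.subset_diff [of S UNIV "\<lambda>i. \<bar>v $ i\<bar>"] by (simp add: Compl_eq_Diff_UNIV)

text \<open>Splitting off one linear factor leaves the exponent \<open>p - 1\<close>, which is
  nonnegative for \<open>1 \<le> p\<close>, so the remaining power is monotone. At
  \<open>x = 0\<close> both sides vanish.\<close>

lemma powr_split:
  fixes x p :: real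
  assumes "0 \<le> x"
  shows "x powr p = x * x powr (p - 1)"
  using assms powr_mult_base [of x "p - 1"] by simp

text \<open>Each power keeps one linear factor, and monotonicity raises the other factor to
  \<open>(a + b) powr (p - 1)\<close>; the linear factors then add up.\<close>

lemma powr_add_le_powr_sum:
  fixes a b p :: real
  assumes "0 \<le> a" "0 \<le> b" "1 \<le> p"
  shows "a powr p + b powr p \<le> (a + b) powr p"
proof (cases "a + b = 0")
  case True
  then have "a = 0" "b = 0" using assms by auto
  then show ?thesis by simp
next
  case False
  have "a * a powr (p - 1) + b * b powr (p - 1)
      \<le> a * (a + b) powr (p - 1) + b * (a + b) powr (p - 1)"
    using assms by (intro add_mono mult_left_mono powr_mono2) auto
  also have "\<dots> = (a + b) powr p"
    using assms powr_split [of "a + b" p] by (simp add: algebra_simps)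
  finally show ?thesis
    using assms powr_split [of a p] powr_split [of b p] by simp
qed

text \<open>The two pieces have disjoint supports, so their p-th powers add exactly; superadditivity
  of t^p then takes the place of Minkowski's inequality.\<close>

lemma lp_norm_le_split:
  assumes "1 \<le> p"
  shows "lp_norm p v \<le> lp_norm p (vec_restrict v S) + lp_norm p (vec_restrict v (- S))"
proof -
  have "(\<Sum>i\<in>UNIV. \<bar>v $ i\<bar> powr p)
      = lp_norm p (vec_restrict v S) powr p + lp_norm p (vec_restrict v (- S)) powr p"
    using assms sum_vec_restrict [of "\<lambda>t. \<bar>t\<bar> powr p" v S]
      sum_vec_restrict [of "\<lambda>t. \<bar>t\<bar> powr p" v "- S"]
      sum.subset_diff [of S UNIV "\<lambda>i. \<bar>v $ i\<bar> powr p"]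
    by (simp add: lp_norm_powr Compl_eq_Diff_UNIV)
  also have "\<dots> \<le> (lp_norm p (vec_restrict v S) + lp_norm p (vec_restrict v (- S))) powr p"
    using assms by (intro powr_add_le_powr_sum lp_norm_nonneg)
  finally show ?thesis
    using assms by (simp add: lp_norm_le_iff lp_norm_nonneg)
qed

text \<open>Jensen's inequality for t^r with equal weights, in effect Hoelder against the indicator
  of \<open>S\<close>. As \<open>1 - 1 / r\<close> is nonnegative, \<open>s\<close> may replace the
  cardinality.\<close>

lemma sum_le_card_powr_mult_sum_powr:
  fixes a :: "'a \<Rightarrow> real"
  assumes "finite S" "\<And>i. i \<in> S \<Longrightarrow> 0 \<le> a i" "card S \<le> s" "1 \<le> s" "1 \<le> r"
  shows "(\<Sum>i\<in>S. a i) \<le> real s powr (1 - 1 / r) * (\<Sum>i\<in>S. a i powr r) powr (1 / r)"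
proof -
  \<comment> \<open>Convexity is used on the open half-line, so zero entries are dropped first;
    neither sum changes and the cardinality only shrinks.\<close>
  define P where "P = {i \<in> S. a i \<noteq> 0}"
  have P: "finite P" "P \<subseteq> S" "card P \<le> s"
    using assms card_mono [of S P] by (auto simp: P_def)
  have sums: "(\<Sum>i\<in>S. a i) = (\<Sum>i\<in>P. a i)" "(\<Sum>i\<in>S. a i powr r) = (\<Sum>i\<in>P. a i powr r)"
    using assms by (auto simp: P_def intro!: sum.mono_neutral_right)
  show ?thesis
  proof (cases "P = {}")
    case True
    then show ?thesis by (simp add: sums)
  next
    case False
    define m where "m = real (card P)"
    have m: "0 < m" "m \<le> real s"
      using False P by (auto simp: m_def card_gt_0_iff)
    have sum_nonneg: "0 \<le> (\<Sum>i\<in>P. a i)"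
      using assms P by (intro sum_nonneg) auto
    have "(\<Sum>i\<in>P. (1 / m) *\<^sub>R a i) powr r \<le> (\<Sum>i\<in>P. (1 / m) * a i powr r)"
    proof (rule convex_on_sum [OF _ False powr_convex])
      show "(\<Sum>i\<in>P. 1 / m) = 1" using m by (simp add: m_def)
      show "a i \<in> {0<..}" if "i \<in> P" for i
        using that assms(2) [of i] P by (auto simp: P_def)
    qed (use P m assms in auto)
    then have "((\<Sum>i\<in>P. a i) / m) powr r \<le> (\<Sum>i\<in>P. a i powr r) / m"
      by (simp add: sum_divide_distrib)
    then have "(((\<Sum>i\<in>P. a i) / m) powr r) powr (1 / r) \<le> ((\<Sum>i\<in>P. a i powr r) / m) powr (1 / r)"
      using assms by (intro powr_mono2) auto
    then have "(\<Sum>i\<in>P. a i) / m \<le> ((\<Sum>i\<in>P. a i powr r) / m) powr (1 / r)"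
      using assms m sum_nonneg by (simp add: powr_powr)
    then have "(\<Sum>i\<in>P. a i) \<le> m powr (1 - 1 / r) * (\<Sum>i\<in>P. a i powr r) powr (1 / r)"
      using m by (simp add: powr_divide powr_diff field_simps sum_nonneg)
    also have "\<dots> \<le> real s powr (1 - 1 / r) * (\<Sum>i\<in>P. a i powr r) powr (1 / r)"
      using m assms by (intro mult_right_mono powr_mono2) auto
    finally show ?thesis by (simp add: sums)
  qed
qed

text \<open>The preceding bound for the numbers \<open>\<bar>v $ i\<bar> powr p\<close> with
  exponent \<open>r = q / p\<close>, followed by a p-th root.\<close>

lemma lp_norm_vec_restrict_le:
  assumes "1 \<le> p" "p \<le> q" "card S \<le> s" "1 \<le> s"
  shows "lp_norm p (vec_restrict v S) \<le> real s powr (1 / p - 1 / q) * lp_norm q (vec_restrict v S)"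
proof -
  have "(\<Sum>i\<in>S. \<bar>v $ i\<bar> powr p)
      \<le> real s powr (1 - 1 / (q / p)) * (\<Sum>i\<in>S. (\<bar>v $ i\<bar> powr p) powr (q / p)) powr (1 / (q / p))"
    using assms by (intro sum_le_card_powr_mult_sum_powr) auto
  also have "\<dots> = real s powr (1 - p / q) * (\<Sum>i\<in>S. \<bar>v $ i\<bar> powr q) powr (p / q)"
    using assms by (simp add: powr_powr)
  also have "\<dots> = (real s powr (1 / p - 1 / q) * lp_norm q (vec_restrict v S)) powr p"
    using assms sum_vec_restrict [of "\<lambda>t. \<bar>t\<bar> powr q" v S]
    by (simp add: lp_norm_def powr_mult powr_powr left_diff_distrib)
  finally show ?thesis
    using assms sum_vec_restrict [of "\<lambda>t. \<bar>t\<bar> powr p" v S]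
    by (simp add: lp_norm_le_iff lp_norm_nonneg)
qed

text \<open>Taking for \<open>S\<close> the entries above the threshold \<open>\<parallel>v\<parallel>\<^sub>1 / s\<close> avoids
  having to sort \<open>v\<close>.\<close>
lemma stechkin:
  fixes v :: "real^'m"
  assumes "1 \<le> p" "1 \<le> s"
  obtains S where "card S \<le> s"
    and "lp_norm p (vec_restrict v (- S)) \<le> lp_norm 1 v / real s powr (1 - 1 / p)"
proof -
  define L where "L = lp_norm 1 v"
  define S where "S = {i. L < real s * \<bar>v $ i\<bar>}"
  have L: "0 \<le> L" by (simp add: L_def lp_norm_nonneg)
  have "card S \<le> s"
  proof (cases "S = {}")
    case False
    \<comment> \<open>Each index of \<open>S\<close> carries more than \<open>L / s\<close> of a
      total mass \<open>L\<close>, so fewer than \<open>s\<close> of them fit.\<close>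
    have "real (card S) * L = (\<Sum>i\<in>S. L)" by simp
    also have "\<dots> < (\<Sum>i\<in>S. real s * \<bar>v $ i\<bar>)"
      using False by (intro sum_strict_mono) (auto simp: S_def)
    also have "\<dots> \<le> real s * L"
      unfolding L_def lp_norm_1 sum_distrib_left by (intro sum_mono2) auto
    finally show ?thesis using L by (simp add: mult_less_cancel_right)
  qed simp
  moreover have "lp_norm p (vec_restrict v (- S)) \<le> L / real s powr (1 - 1 / p)"
  proof -
    \<comment> \<open>Below the threshold, \<open>p - 1\<close> of the \<open>p\<close> powers are
      bounded by \<open>L / s\<close>; the remaining linear factor sums to at most
      \<open>L\<close>.\<close>
    have "(\<Sum>i\<in>- S. \<bar>v $ i\<bar> powr p) \<le> (\<Sum>i\<in>- S. \<bar>v $ i\<bar> * (L / real s) powr (p - 1))"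
    proof (rule sum_mono)
      fix i assume "i \<in> - S"
      then have "\<bar>v $ i\<bar> \<le> L / real s"
        using assms by (simp add: S_def field_simps)
      then show "\<bar>v $ i\<bar> powr p \<le> \<bar>v $ i\<bar> * (L / real s) powr (p - 1)"
        using assms by (subst powr_split) (auto intro!: mult_left_mono powr_mono2)
    qed
    also have "\<dots> \<le> L * (L / real s) powr (p - 1)"
      unfolding sum_distrib_right [symmetric] L_def lp_norm_1
      by (intro mult_right_mono sum_mono2) auto
    also have "\<dots> = L powr p / real s powr (p - 1)"
      using L by (subst powr_split) (auto simp: powr_divide)
    also have "\<dots> = (L / real s powr (1 - 1 / p)) powr p"
      using L assms by (simp add: powr_divide powr_powr left_diff_distrib)
    finally show ?thesis
      using assms L sum_vec_restrict [of "\<lambda>t. \<bar>t\<bar> powr p" v "- S"]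
      by (simp add: lp_norm_le_iff)
  qed
  ultimately show thesis using that by (simp add: L_def)
qed

section \<open>Stability from the robust nullspace property\<close>

lemma best_approx_error_attained:
  obtains S where "card S \<le> s" "best_approx_error s x = lp_norm 1 (vec_restrict x (- S))"
proof -
  have "best_approx_error s x \<in> (\<lambda>S. lp_norm 1 (x - vec_restrict x S)) ` {S. card S \<le> s}"
    unfolding best_approx_error_def by (rule Min_in) (auto intro: exI [of _ "{}"])
  then obtain S where "card S \<le> s" "best_approx_error s x = lp_norm 1 (x - vec_restrict x S)"
    by auto
  then show thesis using that by (simp add: diff_vec_restrict)
qed

lemma best_approx_error_le:
  assumes "card S \<le> s"
  shows "best_approx_error s x \<le> lp_norm 1 (vec_restrict x (- S))"
  unfolding best_approx_error_def diff_vec_restrict [symmetric]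
  using assms by (intro Min_le) auto

text \<open>Comparing the norms on at most \<open>s\<close> entries costs
  \<open>s powr (1 / p - 1 / q)\<close>. This is exactly the change in the normalisation of the tail
  term, so \<open>\<rho>\<close> survives and only \<open>\<tau>\<close> is scaled.\<close>

lemma robust_nullspace_property_mono:
  fixes A :: "real^'m \<Rightarrow> complex^'n^'n"
  assumes "robust_nullspace_property q s nrm A \<rho> \<tau>" "1 \<le> p" "p \<le> q" "1 \<le> s"
  shows "robust_nullspace_property p s nrm A \<rho> (\<tau> * real s powr (1 / p - 1 / q))"
  unfolding robust_nullspace_property_def
proof (intro allI impI)
  fix S :: "'m set" and v
  assume S: "card S \<le> s"
  define c where "c = real s powr (1 / p - 1 / q)"
  have c: "c / real s powr (1 - 1 / q) = 1 / real s powr (1 - 1 / p)"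
    by (simp add: c_def flip: powr_diff powr_minus_divide)
  have "lp_norm p (vec_restrict v S) \<le> c * lp_norm q (vec_restrict v S)"
    unfolding c_def using assms S by (intro lp_norm_vec_restrict_le)
  also have "\<dots> \<le> c * (\<rho> / real s powr (1 - 1 / q) * lp_norm 1 (vec_restrict v (- S)) + \<tau> * nrm (A v))"
    using assms(1) S unfolding robust_nullspace_property_def
    by (intro mult_left_mono) (auto simp: c_def)
  also have "\<dots> = \<rho> * (c / real s powr (1 - 1 / q)) * lp_norm 1 (vec_restrict v (- S)) + \<tau> * c * nrm (A v)"
    by (simp add: algebra_simps)
  finally show "lp_norm p (vec_restrict v S)
      \<le> \<rho> / real s powr (1 - 1 / p) * lp_norm 1 (vec_restrict v (- S))
        + \<tau> * real s powr (1 / p - 1 / q) * nrm (A v)"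
    by (simp add: c) (simp add: c_def)
qed

text \<open>The nullspace property bounds the head of \<open>z - x\<close> by its tail, the triangle
  inequality bounds the tail by the head, and \<open>\<rho> < 1\<close> lets the two be solved. The
  excess \<open>lp_norm 1 z - lp_norm 1 x\<close> stays as an explicit term, so \<open>z\<close> may
  be arbitrary.\<close>

lemma robust_nullspace_property_stable_1:
  assumes "robust_nullspace_property 1 s nrm A \<rho> \<tau>" "0 \<le> \<rho>" "\<rho> < 1" "1 \<le> s"
  shows "lp_norm 1 (z - x)
    \<le> ((1 + \<rho>) * (lp_norm 1 z - lp_norm 1 x + 2 * best_approx_error s x) + 2 * \<tau> * nrm (A (z - x)))
        / (1 - \<rho>)"
proof -
  obtain S where S: "card S \<le> s" "best_approx_error s x = lp_norm 1 (vec_restrict x (- S))"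
    using best_approx_error_attained by blast
  define v where "v = z - x"
  define M where "M = lp_norm 1 z - lp_norm 1 x + 2 * best_approx_error s x"
  define e where "e = \<tau> * nrm (A v)"
  let ?a = "lp_norm 1 (vec_restrict v S)" and ?b = "lp_norm 1 (vec_restrict v (- S))"
  have a: "?a \<le> \<rho> * ?b + e"
    using assms(1,4) S unfolding robust_nullspace_property_def e_def by force
  \<comment> \<open>Adding the two triangle inequalities counts the tail of \<open>x\<close> twice
    relative to its full norm, whence the factor 2 at \<open>best_approx_error\<close>.\<close>
  have "(\<Sum>i\<in>S. \<bar>x $ i\<bar>) \<le> (\<Sum>i\<in>S. \<bar>v $ i\<bar> + \<bar>z $ i\<bar>)"
    by (intro sum_mono) (auto simp: v_def)
  moreover have "(\<Sum>i\<in>- S. \<bar>v $ i\<bar>) \<le> (\<Sum>i\<in>- S. \<bar>x $ i\<bar> + \<bar>z $ i\<bar>)"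
    by (intro sum_mono) (auto simp: v_def)
  ultimately have "?b \<le> M + ?a"
    unfolding M_def S(2) lp_norm_1_split [of z S] lp_norm_1_split [of x S] lp_norm_1_vec_restrict
    by (simp add: sum.distrib)
  with a have b: "(1 - \<rho>) * ?b \<le> M + e"
    by (simp add: algebra_simps)
  have "(1 - \<rho>) * lp_norm 1 v \<le> (1 - \<rho>) * ((1 + \<rho>) * ?b + e)"
    using a assms unfolding lp_norm_1_split [of v S]
    by (intro mult_left_mono) (auto simp: algebra_simps)
  also have "\<dots> = (1 + \<rho>) * ((1 - \<rho>) * ?b) + (1 - \<rho>) * e"
    by (simp add: algebra_simps)
  also have "\<dots> \<le> (1 + \<rho>) * (M + e) + (1 - \<rho>) * e"
    using b assms by (intro add_right_mono mult_left_mono) auto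
  also have "\<dots> = (1 + \<rho>) * M + 2 * e"
    by (simp add: algebra_simps)
  finally show ?thesis
    using assms by (simp add: field_simps M_def e_def v_def)
qed

text \<open>The difference is cut at its own large entries rather than at those of \<open>x\<close>:
  Stechkin's bound handles the tail, the nullspace property the head. Both reduce to the l1 norm of
  the difference, which the case of exponent 1 controls.\<close>

lemma robust_nullspace_property_stable:
  assumes nsp: "robust_nullspace_property q s nrm A \<rho> \<tau>"
    and "0 \<le> \<rho>" "\<rho> < 1" "1 \<le> s" "1 \<le> p" "p \<le> q"
  shows "lp_norm p (z - x)
    \<le> (1 + \<rho>)\<^sup>2 / (1 - \<rho>) / real s powr (1 - 1 / p)
          * (lp_norm 1 z - lp_norm 1 x + 2 * best_approx_error s x)
      + (3 + \<rho>) / (1 - \<rho>) * \<tau> * real s powr (1 / p - 1 / q) * nrm (A (z - x))"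
proof -
  define v where "v = z - x"
  define M where "M = lp_norm 1 z - lp_norm 1 x + 2 * best_approx_error s x"
  define e where "e = \<tau> * nrm (A v)"
  define c where "c = real s powr (1 - 1 / p)"
  define d where "d = real s powr (1 - 1 / q)"
  have c: "0 < c" and d: "0 < d" using assms by (auto simp: c_def d_def)
  have dc: "real s powr (1 / p - 1 / q) = d / c"
    by (simp add: c_def d_def flip: powr_diff)
  obtain S where S: "card S \<le> s" "lp_norm p (vec_restrict v (- S)) \<le> lp_norm 1 v / c"
    using stechkin [of p s v] assms unfolding c_def by blast
  have "lp_norm p (vec_restrict v S) \<le> \<rho> / c * lp_norm 1 (vec_restrict v (- S)) + e * (d / c)"
    using robust_nullspace_property_mono [OF nsp, of p] assms S
    unfolding robust_nullspace_property_def c_def [symmetric] dc e_def by (simp add: mult_ac)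
  also have "\<dots> \<le> \<rho> / c * lp_norm 1 v + e * (d / c)"
    using assms c by (intro add_right_mono mult_left_mono)
      (auto simp: lp_norm_1_split [of v S] lp_norm_nonneg)
  finally have "lp_norm p v \<le> (1 + \<rho>) / c * lp_norm 1 v + e * (d / c)"
    using lp_norm_le_split [of p v S] S(2) assms(5) by (simp add: add_divide_distrib distrib_right)
  \<comment> \<open>Descending from exponent \<open>q\<close> to 1 turns \<open>\<tau>\<close> into
    \<open>\<tau> * d\<close>.\<close>
  also have "\<dots> \<le> (1 + \<rho>) / c * (((1 + \<rho>) * M + 2 * (e * d)) / (1 - \<rho>)) + e * (d / c)"
    using robust_nullspace_property_stable_1 [OF robust_nullspace_property_mono [OF nsp, of 1], of z x]
      assms c unfolding M_def e_def d_def v_def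
    by (intro add_right_mono mult_left_mono) (auto simp: mult_ac)
  \<comment> \<open>The error coefficient is \<open>2 * (1 + \<rho>) / (1 - \<rho>) + 1 = (3 +
    \<rho>) / (1 - \<rho>)\<close>.\<close>
  also have "\<dots> = (1 + \<rho>)\<^sup>2 / (1 - \<rho>) / c * M + (3 + \<rho>) / (1 - \<rho>) * (e * (d / c))"
    using assms c by (simp add: divide_simps power2_eq_square) (simp add: algebra_simps)
  finally show ?thesis
    unfolding dc e_def M_def c_def v_def by (simp add: mult_ac)
qed

section \<open>Positive diagonal rescaling\<close>

text \<open>Weights on \<open>S\<close> cost at most \<open>u\<close>, inverse weights off
  \<open>S\<close> at most \<open>1 / l\<close>. The tail term pays for both, the measurement term
  for \<open>u\<close> alone.\<close>

lemma robust_nullspace_property_rescale: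
  fixes c :: "'m::finite \<Rightarrow> real"
  assumes nsp: "robust_nullspace_property q s nrm A \<rho> \<tau>"
    and "0 < l" "\<And>i. l \<le> c i" "\<And>i. c i \<le> u" "0 \<le> \<rho>" "1 \<le> q"
  shows "robust_nullspace_property q s nrm (\<lambda>v. A (\<chi> i. v $ i / c i)) (u / l * \<rho>) (u * \<tau>)"
  unfolding robust_nullspace_property_def
proof (intro allI impI)
  fix S :: "'m set" and v :: "real^'m"
  assume S: "card S \<le> s"
  define y :: "real^'m" where "y = (\<chi> i. v $ i / c i)"
  have cpos: "0 < c i" for i using assms(2) assms(3) [of i] by linarith
  have u: "0 < u" using cpos assms(4) less_le_trans by blast
  have v: "\<bar>v $ i\<bar> = c i * \<bar>y $ i\<bar>" for i
    using cpos [of i] by (simp add: y_def abs_mult)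
  have "lp_norm q (vec_restrict v S) \<le> lp_norm q (u *\<^sub>R vec_restrict y S)"
    using assms u by (intro lp_norm_mono) (auto simp: vec_restrict_def v abs_mult mult_right_mono)
  also have "\<dots> = u * lp_norm q (vec_restrict y S)"
    using assms u by (simp add: lp_norm_scaleR)
  also have "\<dots> \<le> u * (\<rho> / real s powr (1 - 1 / q) * lp_norm 1 (vec_restrict y (- S)) + \<tau> * nrm (A y))"
    using nsp S u unfolding robust_nullspace_property_def by (intro mult_left_mono) auto
  also have "\<dots> \<le> u * (\<rho> / real s powr (1 - 1 / q) * (lp_norm 1 (vec_restrict v (- S)) / l) + \<tau> * nrm (A y))"
  proof -
    have "lp_norm 1 (l *\<^sub>R vec_restrict y (- S)) \<le> lp_norm 1 (vec_restrict v (- S))"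
      using assms by (intro lp_norm_mono) (auto simp: vec_restrict_def v abs_mult mult_right_mono)
    then have "lp_norm 1 (vec_restrict y (- S)) \<le> lp_norm 1 (vec_restrict v (- S)) / l"
      using assms by (simp add: lp_norm_scaleR field_simps)
    then show ?thesis
      using assms u by (intro mult_left_mono add_right_mono) auto
  qed
  finally show "lp_norm q (vec_restrict v S)
      \<le> u / l * \<rho> / real s powr (1 - 1 / q) * lp_norm 1 (vec_restrict v (- S))
        + u * \<tau> * nrm (A (\<chi> i. v $ i / c i))"
    by (simp add: y_def algebra_simps)
qed

text \<open>An index set optimal for \<open>x\<close> is a competitor for the weighted
  vector.\<close>

lemma best_approx_error_rescale_le:
  fixes c :: "'m::finite \<Rightarrow> real"
  assumes "\<And>i. 0 \<le> c i" "\<And>i. c i \<le> u"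
  shows "best_approx_error s (\<chi> i. c i * x $ i) \<le> u * best_approx_error s x"
proof -
  obtain S where S: "card S \<le> s" "best_approx_error s x = lp_norm 1 (vec_restrict x (- S))"
    using best_approx_error_attained by blast
  have "best_approx_error s (\<chi> i. c i * x $ i) \<le> (\<Sum>i\<in>- S. \<bar>c i * x $ i\<bar>)"
    using best_approx_error_le [OF S(1), of "\<chi> i. c i * x $ i"] by (simp add: lp_norm_1_vec_restrict)
  also have "\<dots> \<le> (\<Sum>i\<in>- S. u * \<bar>x $ i\<bar>)"
    using assms by (intro sum_mono) (auto simp: abs_mult mult_right_mono)
  finally show ?thesis
    by (simp add: S(2) lp_norm_1_vec_restrict sum_distrib_left)
qed

section \<open>Matrix norms and their duals\<close>

lemma matrix_inner_eq: "matrix_inner X Y = (\<Sum>i\<in>UNIV. \<Sum>j\<in>UNIV. cnj (X $ j $ i) * Y $ j $ i)"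
  by (simp add: matrix_inner_def trace_def matrix_matrix_mult_def adjoint_matrix_def transpose_def)

lemma cnj_matrix_inner: "cnj (matrix_inner X Y) = matrix_inner Y X"
  by (simp add: matrix_inner_eq mult.commute)

lemma linear_matrix_inner: "linear (matrix_inner Y)"
  by (rule linearI) (simp_all add: matrix_inner_eq sum.distrib algebra_simps scaleR_sum_right)

text \<open>Here \<open>linear\<close> means real-linear, so a conjugate-linear slot
  qualifies.\<close>

lemma linear_matrix_inner_left: "linear (\<lambda>X. matrix_inner X Y)"
  by (rule linearI) (simp_all add: matrix_inner_eq sum.distrib algebra_simps scaleR_sum_right)

lemma matrix_norm_zero: "is_matrix_norm nrm \<Longrightarrow> nrm 0 = 0"
  by (simp add: is_matrix_norm_def)

lemma matrix_norm_scaleR: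
  assumes "is_matrix_norm nrm"
  shows "nrm (c *\<^sub>R X) = \<bar>c\<bar> * nrm X"
proof -
  have "c *\<^sub>R X = (\<chi> i j. complex_of_real c * X $ i $ j)"
    by (simp add: vec_eq_iff complex_eq_iff)
  then show ?thesis
    using assms unfolding is_matrix_norm_def by (metis norm_of_real)
qed

text \<open>Half of the equivalence of norms in finite dimension: a convex function is continuous,
  hence \<open>nrm\<close> attains a positive minimum on the compact unit sphere.\<close>

lemma matrix_norm_ge_norm:
  fixes nrm :: "complex^'n^'n \<Rightarrow> real"
  assumes nrm: "is_matrix_norm nrm"
  obtains c where "0 < c" "\<And>X. c * norm X \<le> nrm X"
proof -
  have "convex_on UNIV nrm"
  proof (rule convex_onI)
    fix t :: real and X Y
    assume t: "0 < t" "t < 1"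
    have "nrm ((1 - t) *\<^sub>R X + t *\<^sub>R Y) \<le> nrm ((1 - t) *\<^sub>R X) + nrm (t *\<^sub>R Y)"
      using nrm by (simp add: is_matrix_norm_def)
    then show "nrm ((1 - t) *\<^sub>R X + t *\<^sub>R Y) \<le> (1 - t) * nrm X + t * nrm Y"
      using t by (simp add: matrix_norm_scaleR [OF nrm])
  qed simp
  then have "continuous_on UNIV nrm"
    by (rule convex_on_continuous [OF open_UNIV])
  then have "continuous_on (sphere 0 1) nrm"
    by (rule continuous_on_subset) simp
  moreover have "sphere 0 1 \<noteq> ({} :: (complex^'n^'n) set)"
    by simp
  ultimately obtain Z where Z: "Z \<in> sphere 0 1" "\<And>X. X \<in> sphere 0 1 \<Longrightarrow> nrm Z \<le> nrm X"
    using continuous_attains_inf [OF compact_sphere] by metis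
  have "0 < nrm Z"
    using Z(1) nrm unfolding is_matrix_norm_def
    by (metis less_eq_real_def mem_sphere_0 norm_zero zero_neq_one)
  moreover have "nrm Z * norm X \<le> nrm X" for X
  proof (cases "X = 0")
    case True
    then show ?thesis using nrm by (simp add: is_matrix_norm_def)
  next
    case False
    then have "nrm Z \<le> nrm ((1 / norm X) *\<^sub>R X)"
      by (intro Z(2)) simp
    then show ?thesis
      using False by (simp add: matrix_norm_scaleR [OF nrm] field_simps)
  qed
  ultimately show thesis by (rule that)
qed

text \<open>Boundedness is what makes the real supremum in \<open>dual_norm\<close> an upper bound.
  It holds because the unit ball of \<open>nrm\<close> is bounded in the Euclidean norm.\<close>

lemma bdd_above_dual_norm:
  assumes nrm: "is_matrix_norm nrm"
  shows "bdd_above ((\<lambda>X. cmod (matrix_inner Y X)) ` {X. nrm X \<le> 1})"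
proof -
  obtain c where c: "0 < c" "\<And>X. c * norm X \<le> nrm X"
    using matrix_norm_ge_norm [OF nrm] by blast
  have "bounded_linear (matrix_inner Y)"
    using linear_matrix_inner linear_conv_bounded_linear by blast
  then obtain K where K: "0 < K" "\<And>X. cmod (matrix_inner Y X) \<le> norm X * K"
    using bounded_linear.pos_bounded by blast
  show ?thesis
  proof (rule bdd_aboveI2)
    fix X assume "X \<in> {X. nrm X \<le> 1}"
    then have "norm X \<le> 1 / c"
      using c(1) c(2) [of X] by (simp add: field_simps)
    then have "norm X * K \<le> 1 / c * K"
      using K by (intro mult_right_mono) auto
    then show "cmod (matrix_inner Y X) \<le> 1 / c * K"
      using K(2) [of X] by linarith
  qed
qed

lemma dual_norm_nonneg:
  assumes nrm: "is_matrix_norm nrm"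
  shows "0 \<le> dual_norm nrm Y"
proof -
  have "cmod (matrix_inner Y 0) \<le> dual_norm nrm Y"
    unfolding dual_norm_def using nrm
    by (intro cSUP_upper bdd_above_dual_norm) (simp_all add: matrix_norm_zero)
  then show ?thesis
    using norm_ge_zero order_trans by blast
qed

lemma cmod_matrix_inner_le:
  assumes nrm: "is_matrix_norm nrm"
  shows "cmod (matrix_inner Y X) \<le> dual_norm nrm Y * nrm X"
proof (cases "X = 0")
  case True
  then show ?thesis
    using nrm by (simp add: linear_0 [OF linear_matrix_inner] matrix_norm_zero)
next
  case False
  then have pos: "0 < nrm X"
    using nrm unfolding is_matrix_norm_def by (metis less_eq_real_def)
  have "cmod (matrix_inner Y ((1 / nrm X) *\<^sub>R X)) \<le> dual_norm nrm Y"
    unfolding dual_norm_def using pos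
    by (intro cSUP_upper bdd_above_dual_norm [OF nrm]) (simp add: matrix_norm_scaleR [OF nrm])
  then show ?thesis
    using pos by (simp add: linear_scale [OF linear_matrix_inner] field_simps)
qed

text \<open>The adjoint is given by its values on the standard basis; expanding \<open>v\<close>
  there yields its defining identity. The coefficients are real and pass through the
  conjugate-linear slot unchanged.\<close>

lemma sum_measurement_adjoint:
  assumes "linear A"
  shows "(\<Sum>i\<in>UNIV. v $ i *\<^sub>R measurement_adjoint A T $ i) = matrix_inner (A v) T"
proof -
  have lin: "linear (\<lambda>v. matrix_inner (A v) T)"
    using linear_compose [OF assms linear_matrix_inner_left] by (simp add: o_def)
  have "v = (\<Sum>i\<in>UNIV. v $ i *\<^sub>R axis i 1)"
    using basis_expansion [of v] by (simp add: scalar_mult_eq_scaleR)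
  then have "matrix_inner (A v) T = matrix_inner (A (\<Sum>i\<in>UNIV. v $ i *\<^sub>R axis i 1)) T"
    by simp
  also have "\<dots> = (\<Sum>i\<in>UNIV. v $ i *\<^sub>R measurement_adjoint A T $ i)"
    by (simp add: linear_sum [OF lin] linear_scale [OF lin] measurement_adjoint_def)
  finally show ?thesis ..
qed


section \<open>Error bound for nonnegative recovery\<close>

theorem theorem1:
  fixes q p \<rho> \<tau> :: real and s :: nat
    and nrm :: "complex^'n^'n \<Rightarrow> real"
    and A :: "real^'m \<Rightarrow> complex^'n^'n"
    and T E :: "complex^'n^'n"
    and x xs :: "real^'m"
  assumes "1 \<le> q" and "1 \<le> s"
    and "is_matrix_norm nrm"
    and "linear A"
    and "0 \<le> \<rho>" and "\<rho> < 1" and "0 < \<tau>"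
    and "robust_nullspace_property q s nrm A \<rho> \<tau>"
    and "strictly_positive (measurement_adjoint A T)"
    and "\<rho> * kappa (measurement_adjoint A T) < 1"
    and "\<forall>i. 0 \<le> x $ i"
    and "is_arg_min (\<lambda>z. nrm (A z - (A x + E))) (\<lambda>z. \<forall>i. 0 \<le> z $ i) xs"
    and "1 \<le> p" and "p \<le> q"
  shows
    "let \<kappa> = kappa (measurement_adjoint A T);
         C' = 2 * ((1 + \<kappa> * \<rho>)\<^sup>2 / (1 - \<kappa> * \<rho>));
         D' = 2 * ((3 + \<kappa> * \<rho>) / (1 - \<kappa> * \<rho>));
         \<theta> = inverse (linf_norm (measurement_adjoint A T)) * dual_norm nrm T
     in lp_norm p (xs - x)
          \<le> C' * \<kappa> * best_approx_error s x / real s powr (1 - 1 / p)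
            + D' * \<kappa> / real s powr (1 / q - 1 / p)
              * (\<tau> + \<theta> / real s powr (1 - 1 / q)) * nrm E"
proof -
  define w where "w = measurement_adjoint A T"
  define c where "c i = Re (w $ i)" for i
  define u where "u = linf_norm w"
  define l where "l = Min (range (\<lambda>i. cmod (w $ i)))"
  define \<kappa> where "\<kappa> = kappa w"
  define a where "a = \<kappa> * \<rho>"
  define G where "G = nrm (A (xs - x))"
  define W :: "real^'m \<Rightarrow> real^'m" where "W v = (\<chi> i. c i * v $ i)" for v
  have w: "w $ i = complex_of_real (c i)" "0 < c i" for i
    using assms(9) by (auto simp: strictly_positive_def w_def c_def of_real_Re)
  have cmod_w: "cmod (w $ i) = c i" for i
    using w(2) [of i] by (simp add: w(1))
  have lc: "l \<le> c i" and cu: "c i \<le> u" for i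
    unfolding l_def u_def linf_norm_def cmod_w by (auto intro: Min_le Max_ge)
  have "l \<in> range c"
    unfolding l_def cmod_w by (rule Min_in) auto
  then have l: "0 < l" using w(2) by auto
  have u: "0 < u" using w(2) cu less_le_trans by blast
  have \<kappa>: "\<kappa> = u / l"
    by (simp add: \<kappa>_def kappa_def u_def linf_norm_def l_def)
  have a: "0 \<le> a" "a < 1"
    using assms(5,10) l u by (simp_all add: a_def \<kappa> mult.commute flip: w_def \<kappa>_def)
  have xs: "0 \<le> xs $ i" for i
    using assms(12) by (simp add: is_arg_min_def)

  \<comment> \<open>The vector \<open>x\<close> is itself feasible, with residual
    \<open>- E\<close>.\<close>
  have "nrm (A xs - (A x + E)) \<le> nrm (A x - (A x + E))"
    using assms(11,12) unfolding is_arg_min_def by (meson linorder_not_le)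
  also have "\<dots> = nrm E"
    using matrix_norm_scaleR [OF assms(3), of "- 1" E] by simp
  finally have "nrm ((A xs - (A x + E)) + E) \<le> nrm E + nrm E"
    using assms(3) unfolding is_matrix_norm_def by (smt (verit))
  then have G: "G \<le> 2 * nrm E"
    by (simp add: G_def linear_diff [OF assms(4)])
  have G0: "0 \<le> G"
    using assms(3) by (simp add: G_def is_matrix_norm_def)

  \<comment> \<open>Nonnegativity of \<open>xs\<close> and \<open>x\<close> removes the absolute
    values, which makes the difference linear in \<open>xs - x\<close>.\<close>
  have "lp_norm 1 (W xs) - lp_norm 1 (W x) = (\<Sum>i\<in>UNIV. (xs - x) $ i * c i)"
    using assms(11) xs less_imp_le [OF w(2)]
    by (simp add: lp_norm_1 W_def abs_mult algebra_simps flip: sum_subtractf)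
  also have "\<dots> = Re (\<Sum>i\<in>UNIV. (xs - x) $ i *\<^sub>R w $ i)"
    by (simp add: w(1))
  also have "\<dots> = Re (matrix_inner (A (xs - x)) T)"
    by (simp only: w_def sum_measurement_adjoint [OF assms(4)])
  also have "\<dots> \<le> cmod (matrix_inner T (A (xs - x)))"
    by (metis cnj_matrix_inner complex_Re_le_cmod complex_mod_cnj)
  also have "\<dots> \<le> dual_norm nrm T * G"
    unfolding G_def by (rule cmod_matrix_inner_le [OF assms(3)])
  finally have diff: "lp_norm 1 (W xs) - lp_norm 1 (W x) \<le> dual_norm nrm T * G" .

  define \<sigma> where "\<sigma> = best_approx_error s x"
  define b where "b = real s powr (1 - 1 / p)"
  define d where "d = real s powr (1 - 1 / q)"
  have b: "0 < b" and d: "0 < d" using assms by (auto simp: b_def d_def)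
  have db: "real s powr (1 / p - 1 / q) = d / b" "real s powr (1 / q - 1 / p) = b / d"
    by (simp_all add: b_def d_def flip: powr_diff)
  define C where "C = (1 + a)\<^sup>2 / (1 - a)"
  define D where "D = (3 + a) / (1 - a)"
  have C: "0 \<le> C" using a by (simp add: C_def)
  \<comment> \<open>Needed for \<open>C \<le> D\<close>, which lets the dual norm term, arising with
    \<open>C\<close>, share the constant of the \<open>\<tau>\<close> term.\<close>
  have "(1 + a)\<^sup>2 \<le> 3 + a"
  proof -
    have "0 \<le> (1 - a) * (2 + a)" using a by (intro mult_nonneg_nonneg) auto
    then show ?thesis by (simp add: power2_eq_square algebra_simps)
  qed
  then have CD: "C \<le> D" using a by (simp add: C_def D_def divide_right_mono)

  have nsp: "robust_nullspace_property q s nrm (\<lambda>v. A (\<chi> i. v $ i / c i)) a (u * \<tau>)"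
    using robust_nullspace_property_rescale [OF assms(8) l lc cu assms(5,1)] by (simp add: a_def \<kappa>)
  \<comment> \<open>Undoing the weights inside the rescaled map leaves the original residual
    \<open>A (xs - x)\<close>.\<close>
  have inv: "(\<chi> i. (W xs - W x) $ i / c i) = xs - x"
    using less_imp_neq [OF w(2)] by (auto simp: vec_eq_iff W_def field_simps)
  \<comment> \<open>Removing the weights costs \<open>1 / l\<close>; together with the factors
    \<open>u\<close> this gives \<open>\<kappa> = u / l\<close>.\<close>
  have "lp_norm p (l *\<^sub>R (xs - x)) \<le> lp_norm p (W xs - W x)"
    using assms(13) l lc w(2)
    by (intro lp_norm_mono)
      (auto simp: W_def abs_mult less_imp_le mult_right_mono simp flip: right_diff_distrib)
  also have "\<dots> \<le> C / b * (lp_norm 1 (W xs) - lp_norm 1 (W x) + 2 * best_approx_error s (W x))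
      + D * (u * \<tau>) * (d / b) * G"
    using robust_nullspace_property_stable [OF nsp a assms(2,13,14), of "W xs" "W x"]
    unfolding inv C_def D_def G_def b_def db(1) [unfolded b_def] .
  also have "\<dots> \<le> C / b * (dual_norm nrm T * G + 2 * (u * \<sigma>)) + D * (u * \<tau>) * (d / b) * G"
    using diff C b best_approx_error_rescale_le [of c u s x] less_imp_le [OF w(2)] cu
    by (intro add_right_mono mult_left_mono add_mono) (auto simp: W_def \<sigma>_def)
  also have "\<dots> = C / b * 2 * u * \<sigma> + (C / b * dual_norm nrm T + D * u * \<tau> * (d / b)) * G"
    by (simp add: algebra_simps)
  also have "\<dots> \<le> C / b * 2 * u * \<sigma> + (D / b * dual_norm nrm T + D * u * \<tau> * (d / b)) * (2 * nrm E)"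
    using CD C G G0 b d u assms(7) dual_norm_nonneg [OF assms(3), of T]
    by (intro add_left_mono mult_mono add_right_mono mult_right_mono divide_right_mono)
      (auto intro!: add_nonneg_nonneg mult_nonneg_nonneg)
  finally have "lp_norm p (xs - x)
      \<le> (C / b * 2 * u * \<sigma> + (D / b * dual_norm nrm T + D * u * \<tau> * (d / b)) * (2 * nrm E)) / l"
    using assms(13) l by (simp add: lp_norm_scaleR pos_le_divide_eq mult.commute)
  \<comment> \<open>Taking \<open>u\<close> out of the error term divides the dual norm by
    \<open>u\<close>, which produces \<open>\<theta>\<close>. The 2 in \<open>C'\<close> is that of
    the best approximation error, the 2 in \<open>D'\<close> that of
    \<open>G \<le> 2 * nrm E\<close>.\<close>
  also have "\<dots> = 2 * C * \<kappa> * \<sigma> / b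
      + 2 * D * \<kappa> / (b / d) * (\<tau> + inverse u * dual_norm nrm T / d) * nrm E"
    using l u b d by (simp add: \<kappa> field_simps)
  finally show ?thesis
    unfolding Let_def
    by (simp add: C_def D_def a_def \<kappa>_def \<sigma>_def u_def w_def b_def d_def db(2) [unfolded b_def d_def])
qed

end
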